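(* Let $h:\mathcal Y\to\mathbb R$ be a mirror map with $\Delta(\mathcal A)\subseteq\mathcal Y\subseteq\mathbb R^{|\mathcal A|}$, let $\mathcal F^\Theta$ be a parameterized class of functions $f^\theta:\mathcal S\times\mathcal A\to\mathbb R$, and let $\eta>0$. For any policy $\pi$, any policy $\bar\pi$ with $\bar\pi_s\in\operatorname{int}\mathcal Y$ for all $s\in\mathcal S$, and any $f^\theta\in\mathcal F^\Theta$, we have for all $s\in\mathcal S$ $$\langle\eta f^\theta_s-\nabla h(\bar\pi_s),\ \pi_s-\tilde\pi_s\rangle\le\mathcal D_h(\pi_s,\bar\pi_s)-\mathcal D_h(\tilde\pi_s,\bar\pi_s)-\mathcal D_h(\pi_s,\tilde\pi_s),$$ where $\tilde\pi$ is the policy given by $\tilde\pi_s=\arg\min_{p\in\Delta(\mathcal A)}\mathcal D_h(p,\nabla h^*(\eta f^\theta_s))$ for all $s\in\mathcal S$.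
   Context: $\mathcal S$ is a set (states), $\mathcal A$ a finite set (actions), $\Delta(\mathcal A)$ the probability simplex in $\mathbb R^{|\mathcal A|}$. A policy $\pi$ assigns to each $s\in\mathcal S$ a vector $\pi_s=[\pi(a\mid s)]_{a\in\mathcal A}\in\Delta(\mathcal A)$. $f^\theta_s=[f^\theta(s,a)]_{a\in\mathcal A}\in\mathbb R^{|\mathcal A|}$. Mirror map: $\mathcal Y\subseteq\mathbb R^{|\mathcal A|}$ is convex; $h:\mathcal Y\to\mathbb R$ is strictly convex, continuous on $\mathcal Y$, continuously differentiable on $\operatorname{int}\mathcal Y$, essentially smooth ($\|\nabla h(x)\|_2\to+\infty$ as $x\to\partial\mathcal Y$), and $\nabla h(\operatorname{int}\mathcal Y)=\mathbb R^{|\mathcal A|}$. $h^*(x^* )=\sup_{x\in\mathcal Y}\langle x^*,x\rangle-h(x)$ for $x^*\in\mathbb R^{|\mathcal A|}$; $\nabla h^*$ is the inverse of $\nabla h$. Bregman divergence: $\mathcal D_h(x,y)=h(x)-h(y)-\langle\nabla h(y),x-y\rangle$ for $x\in\mathcal Y$, $y\in\operatorname{int}\mathcal Y$. *)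

theory Defs
  imports "HOL-Analysis.Analysis"
begin

text \<open>The finite action set is the index type \<open>'a\<close>, so vectors indexed by actions live in
  \<^typ>\<open>real ^ 'a\<close>.  A mirror map is a function on \<open>Y\<close>; it is represented by a
  total function of which only the values on \<open>Y\<close> are used.\<close>

definition action_simplex :: "(real ^ 'a) set" where
  "action_simplex = {p. (\<forall>a. 0 \<le> p $ a) \<and> (\<Sum>a\<in>UNIV. p $ a) = 1}"

definition is_policy :: "('s \<Rightarrow> real ^ 'a) \<Rightarrow> bool" where
  "is_policy \<pi> \<longleftrightarrow> (\<forall>s. \<pi> s \<in> action_simplex)"

definition action_vec :: "('s \<times> 'a \<Rightarrow> real) \<Rightarrow> 's \<Rightarrow> real ^ 'a" where
  "action_vec f s = (\<chi> a. f (s, a))"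

definition grad :: "('b::real_inner \<Rightarrow> real) \<Rightarrow> 'b \<Rightarrow> 'b" where
  "grad h x = (THE D. GDERIV h x :> D)"

definition strictly_convex_on :: "'b::real_vector set \<Rightarrow> ('b \<Rightarrow> real) \<Rightarrow> bool" where
  "strictly_convex_on Y h \<longleftrightarrow> convex Y \<and>
     (\<forall>x\<in>Y. \<forall>y\<in>Y. \<forall>t. x \<noteq> y \<longrightarrow> 0 < t \<longrightarrow> t < 1 \<longrightarrow>
        h ((1 - t) *\<^sub>R x + t *\<^sub>R y) < (1 - t) * h x + t * h y)"

text \<open>Blow-up of the gradient is required along every approach, from the interior, to a boundary
  point; the boundary point itself need not belong to \<open>Y\<close>.\<close>

definition essentially_smooth_on :: "'b::real_inner set \<Rightarrow> ('b \<Rightarrow> real) \<Rightarrow> bool" where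
  "essentially_smooth_on Y h \<longleftrightarrow>
     (\<forall>y\<in>frontier Y. filterlim (\<lambda>x. norm (grad h x)) at_top (at y within interior Y))"

definition mirror_map :: "'b::euclidean_space set \<Rightarrow> ('b \<Rightarrow> real) \<Rightarrow> bool" where
  "mirror_map Y h \<longleftrightarrow>
     convex Y \<and>
     strictly_convex_on Y h \<and>
     continuous_on Y h \<and>
     h differentiable_on interior Y \<and>
     continuous_on (interior Y) (grad h) \<and>
     essentially_smooth_on Y h \<and>
     grad h ` interior Y = UNIV"

text \<open>The supremum is taken in \<^typ>\<open>real\<close>.  For a mirror map it is finite, since each
  \<open>z\<close> is a gradient of \<open>h\<close> at an interior point of \<open>Y\<close>.\<close>

definition conjugate_on :: "'b::real_inner set \<Rightarrow> ('b \<Rightarrow> real) \<Rightarrow> 'b \<Rightarrow> real" where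
  "conjugate_on Y h z = (SUP x\<in>Y. z \<bullet> x - h x)"

text \<open>Meaningful for \<open>x \<in> Y\<close> and \<open>y \<in> interior Y\<close>.\<close>

definition bregman :: "('b::real_inner \<Rightarrow> real) \<Rightarrow> 'b \<Rightarrow> 'b \<Rightarrow> real" where
  "bregman h x y = h x - h y - grad h y \<bullet> (x - y)"

end

theory Submission
  imports Defs
begin

text \<open>By the three-point identity the claim is the first-order optimality condition, over the
  simplex, of \<open>p \<mapsto> h p - z \<bullet> p\<close> with \<open>z = \<eta> f\<^sub>s\<close>: this function and the Bregman divergence to
  \<open>\<nabla>h\<^sup>*(z) = (\<nabla>h)\<^sup>-\<^sup>1(z)\<close> differ by a constant.  Two points need an argument.  First,
  \<open>\<nabla>h\<^sup>*\<close> inverts \<open>\<nabla>h\<close>: the gradient is a continuous bijection from the interior of \<open>Y\<close>, so its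
  inverse is continuous by invariance of domain, and this makes \<open>h\<^sup>*\<close> differentiable.  Second,
  \<open>h\<close> is differentiable at the minimiser: were the minimiser a boundary point, then on the segment
  to an interior point of the simplex, optimality would bound the slopes below and convexity would
  then bound the gradients, against essential smoothness.\<close>

section \<open>Gradients and one-sided directional derivatives\<close>

lemma GDERIV_unique:
  assumes "GDERIV f x :> D" "GDERIV f x :> E"
  shows "D = E"
proof -
  have "(\<lambda>v. v \<bullet> D) = (\<lambda>v. v \<bullet> E)"
    using assms has_derivative_unique unfolding gderiv_def by blast
  then show ?thesis
    by (metis inner_commute vector_eq_ldot)
qed

lemma grad_eqI: "GDERIV f x :> D \<Longrightarrow> grad f x = D"
  unfolding grad_def by (blast intro: GDERIV_unique)

text \<open>Riesz representation in coordinates: \<open>D\<close> collects the values of the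
  derivative on the basis. This gives the definite description in \<open>grad\<close> its
  meaning.\<close>

lemma differentiable_GDERIV_grad:
  fixes f :: "'b::euclidean_space \<Rightarrow> real"
  assumes "f differentiable (at x)"
  shows "GDERIV f x :> grad f x"
proof -
  obtain f' where f': "(f has_derivative f') (at x)"
    using assms by (auto simp: differentiable_def)
  define D where "D = (\<Sum>b\<in>Basis. f' b *\<^sub>R b)"
  interpret f': linear f'
    using f' by (rule has_derivative_linear)
  have "f' v = v \<bullet> D" for v
  proof -
    have "f' v = f' (\<Sum>b\<in>Basis. (v \<bullet> b) *\<^sub>R b)"
      by (simp add: euclidean_representation)
    also have "\<dots> = v \<bullet> D"
      by (simp add: f'.sum f'.scaleR D_def inner_sum_right mult.commute)
    finally show ?thesis .
  qed
  then have "f' = (\<lambda>v. v \<bullet> D)" by blast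
  then have "GDERIV f x :> D"
    using f' by (simp add: gderiv_def)
  then show ?thesis
    using grad_eqI by blast
qed

text \<open>The limit is one-sided because convexity and optimality will control the quotient for
  \<open>0 < t\<close>, \<open>t < 1\<close> only.\<close>

lemma GDERIV_directional:
  fixes f :: "'b::real_inner \<Rightarrow> real"
  assumes "GDERIV f x :> D"
  shows "((\<lambda>t. (f (x + t *\<^sub>R v) - f x) / t) \<longlongrightarrow> D \<bullet> v) (at_right 0)"
proof -
  have "((\<lambda>t. x + t *\<^sub>R v) has_derivative (\<lambda>t. t *\<^sub>R v)) (at 0)"
    by (auto intro!: derivative_eq_intros)
  moreover have "(f has_derivative (\<lambda>v. v \<bullet> D)) (at (x + 0 *\<^sub>R v))"
    using assms by (simp add: gderiv_def)
  ultimately have "((\<lambda>t. f (x + t *\<^sub>R v)) has_derivative (\<lambda>t. (t *\<^sub>R v) \<bullet> D)) (at 0)"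
    by (rule has_derivative_compose)
  then have "((\<lambda>t. f (x + t *\<^sub>R v)) has_field_derivative D \<bullet> v) (at 0)"
    by (rule has_derivative_imp_has_field_derivative) (simp add: inner_commute)
  then have "((\<lambda>t. (f (x + t *\<^sub>R v) - f x) / t) \<longlongrightarrow> D \<bullet> v) (at 0)"
    by (simp add: DERIV_def)
  then show ?thesis
    by (rule filterlim_mono) (auto simp: at_within_le_at)
qed

text \<open>\<open>arg_min_on\<close> is a choice operator: its value is known to minimise once some
  minimiser has been exhibited.\<close>

lemma arg_min_on_attained:
  assumes "x \<in> S" "\<And>y. y \<in> S \<Longrightarrow> f x \<le> (f y :: 'c::linorder)"
  shows "arg_min_on f S \<in> S" "\<And>y. y \<in> S \<Longrightarrow> f (arg_min_on f S) \<le> f y"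
proof -
  have "is_arg_min f (\<lambda>x. x \<in> S) x"
    using assms by (auto simp: is_arg_min_def not_less)
  then have "is_arg_min f (\<lambda>x. x \<in> S) (arg_min_on f S)"
    unfolding arg_min_on_def arg_min_def by (rule someI)
  then show "arg_min_on f S \<in> S" "\<And>y. y \<in> S \<Longrightarrow> f (arg_min_on f S) \<le> f y"
    by (auto simp: is_arg_min_def not_less)
qed

section \<open>The probability simplex\<close>

lemma convex_action_simplex: "convex action_simplex"
  unfolding action_simplex_def convex_def
  by (auto simp: sum.distrib sum_distrib_left[symmetric])

lemma compact_action_simplex: "compact (action_simplex :: (real ^ 'a) set)"
proof -
  have "closed ({p. \<forall>a. 0 \<le> p $ a} \<inter> {p :: real ^ 'a. (\<Sum>a\<in>UNIV. p $ a) = 1})"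
    by (intro closed_Int closed_Collect_all closed_Collect_le closed_Collect_eq continuous_intros)
  then have "closed (action_simplex :: (real ^ 'a) set)"
    by (simp add: action_simplex_def Collect_conj_eq)
  moreover have "norm p \<le> 1" if "p \<in> action_simplex" for p :: "real ^ 'a"
    using norm_le_l1_cart[of p] that by (simp add: action_simplex_def)
  ultimately show ?thesis
    by (auto simp: compact_eq_bounded_closed bounded_iff)
qed

section \<open>Gradient inequalities and the conjugate of a mirror map\<close>

context
  fixes Y :: "'b::euclidean_space set" and h :: "'b \<Rightarrow> real"
  assumes mirror: "mirror_map Y h"
begin

lemma mirror_map_GDERIV: "x \<in> interior Y \<Longrightarrow> GDERIV h x :> grad h x"
  using mirror
  by (auto simp: mirror_map_def differentiable_on_def at_within_open[OF _ open_interior]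
      intro!: differentiable_GDERIV_grad)

text \<open>Convexity bounds the difference quotients at \<open>x\<close> towards \<open>y\<close>
  by \<open>h y - h x\<close>, and the bound passes to the limit. Here \<open>y\<close> may be a
  boundary point of \<open>Y\<close>.\<close>

lemma mirror_map_gradient_ineq:
  assumes x: "x \<in> interior Y" and y: "y \<in> Y"
  shows "h x + grad h x \<bullet> (y - x) \<le> h y"
proof (cases "x = y")
  case False
  have "(h (x + t *\<^sub>R (y - x)) - h x) / t \<le> h y - h x" if "0 < t" "t < 1" for t
  proof -
    have "h ((1 - t) *\<^sub>R x + t *\<^sub>R y) < (1 - t) * h x + t * h y"
      using mirror False that y interior_subset[of Y] x
      unfolding mirror_map_def strictly_convex_on_def by blast
    moreover have "(1 - t) *\<^sub>R x + t *\<^sub>R y = x + t *\<^sub>R (y - x)"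
      by (simp add: algebra_simps)
    ultimately show ?thesis
      using that by (simp add: field_simps)
  qed
  then have "\<forall>\<^sub>F t in at_right 0. (h (x + t *\<^sub>R (y - x)) - h x) / t \<le> h y - h x"
    by (auto intro!: eventually_at_rightI[of 0 1])
  from tendsto_upperbound[OF GDERIV_directional[OF mirror_map_GDERIV[OF x]] this]
  show ?thesis by simp
qed simp

text \<open>The limit loses strictness; it is regained by applying the weak inequality at the
  midpoint \<open>m\<close>, where strict convexity holds.\<close>

lemma mirror_map_gradient_ineq_strict:
  assumes x: "x \<in> interior Y" and y: "y \<in> Y" and "x \<noteq> y"
  shows "h x + grad h x \<bullet> (y - x) < h y"
proof -
  define m where "m = (1 - 1/2) *\<^sub>R x + (1/2) *\<^sub>R y"
  have "x \<in> Y" using x interior_subset by blast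
  have "convex Y" using mirror by (simp add: mirror_map_def)
  then have "m \<in> Y"
    unfolding m_def using \<open>x \<in> Y\<close> y by (intro convexD_alt) auto
  have "h m < (1 - 1/2) * h x + 1/2 * h y"
    using mirror \<open>x \<in> Y\<close> y \<open>x \<noteq> y\<close>
    unfolding mirror_map_def strictly_convex_on_def m_def
    by (metis half_gt_zero_iff zero_less_one field_sum_of_halves less_add_same_cancel1)
  moreover have "m - x = (1/2) *\<^sub>R (y - x)"
    by (simp add: m_def algebra_simps flip: scaleR_left_distrib)
  then have "h x + (grad h x \<bullet> (y - x)) / 2 \<le> h m"
    using mirror_map_gradient_ineq[OF x \<open>m \<in> Y\<close>] by simp
  ultimately show ?thesis by simp
qed

lemma mirror_map_inj_on_grad: "inj_on (grad h) (interior Y)"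
proof (rule inj_onI, rule ccontr)
  fix x y
  assume *: "x \<in> interior Y" "y \<in> interior Y" "grad h x = grad h y" "x \<noteq> y"
  then have "x \<in> Y" "y \<in> Y" using interior_subset by blast+
  have "h x + grad h x \<bullet> (y - x) < h y" "h y + grad h y \<bullet> (x - y) < h x"
    using * \<open>x \<in> Y\<close> \<open>y \<in> Y\<close> mirror_map_gradient_ineq_strict[of x y]
      mirror_map_gradient_ineq_strict[of y x] by blast+
  then show False
    using * by (simp add: inner_diff_right)
qed

text \<open>Equality case of Fenchel-Young: by the gradient inequality, the supremum is attained at
  \<open>w\<close>.\<close>

lemma conjugate_on_grad:
  assumes "w \<in> interior Y"
  shows "conjugate_on Y h (grad h w) = grad h w \<bullet> w - h w"
  unfolding conjugate_on_def
proof (rule cSup_eq_maximum)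
  show "grad h w \<bullet> w - h w \<in> (\<lambda>x. grad h w \<bullet> x - h x) ` Y"
    using assms interior_subset by blast
next
  fix u assume "u \<in> (\<lambda>x. grad h w \<bullet> x - h x) ` Y"
  then show "u \<le> grad h w \<bullet> w - h w"
    using mirror_map_gradient_ineq[OF assms] by (force simp: inner_diff_right)
qed

lemma grad_conjugate_on:
  assumes w: "w \<in> interior Y"
  shows "grad (conjugate_on Y h) (grad h w) = w"
proof (rule grad_eqI)
  have cont: "continuous_on (interior Y) (grad h)" and surj: "grad h ` interior Y = UNIV"
    using mirror by (auto simp: mirror_map_def)
  \<comment> \<open>\<open>k\<close> inverts the gradient; surjectivity makes it continuous on the
    whole space.\<close>
  obtain k where "homeomorphism (interior Y) (grad h ` interior Y) (grad h) k"
    using invariance_of_domain_homeomorphism[OF open_interior cont _ mirror_map_inj_on_grad] by auto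
  then have contk: "continuous_on UNIV k" and kint: "\<And>z. k z \<in> interior Y"
    and gk: "\<And>z. grad h (k z) = z" and kg: "k (grad h w) = w"
    using w by (auto simp: homeomorphism_def surj)
  let ?z = "grad h w"
  have est: "norm (conjugate_on Y h z' - conjugate_on Y h ?z - (z' - ?z) \<bullet> w)
      \<le> norm (k z' - w) * norm (z' - ?z)" for z'
  proof -
    have c: "conjugate_on Y h z' = z' \<bullet> k z' - h (k z')"
      using conjugate_on_grad[OF kint[of z']] by (simp add: gk)
    \<comment> \<open>Gradient inequalities based at \<open>w\<close> and at \<open>k z'\<close>
      trap the first-order remainder of the conjugate between 0 and an inner product, which is small
      because \<open>k\<close> is continuous.\<close>
    have "h w + ?z \<bullet> (k z' - w) \<le> h (k z')" "h (k z') + z' \<bullet> (w - k z') \<le> h w"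
      using mirror_map_gradient_ineq[OF w] mirror_map_gradient_ineq[OF kint[of z']]
        kint[of z'] w interior_subset[of Y] by (auto simp: gk)
    then have "0 \<le> conjugate_on Y h z' - conjugate_on Y h ?z - (z' - ?z) \<bullet> w"
      "conjugate_on Y h z' - conjugate_on Y h ?z - (z' - ?z) \<bullet> w \<le> (k z' - w) \<bullet> (z' - ?z)"
      using w by (auto simp: c conjugate_on_grad algebra_simps inner_commute)
    then show ?thesis
      using norm_cauchy_schwarz[of "k z' - w" "z' - ?z"] by simp
  qed
  show "GDERIV (conjugate_on Y h) ?z :> w"
    unfolding gderiv_def has_derivative_at_alt
  proof (intro conjI allI impI)
    show "bounded_linear (\<lambda>v. v \<bullet> w)" by (rule bounded_linear_inner_left)
  next
    fix e :: real assume "0 < e"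
    then obtain d where "d > 0" and d: "\<And>z'. dist z' ?z < d \<Longrightarrow> dist (k z') w < e"
      using contk kg unfolding continuous_on_iff by (metis UNIV_I)
    have "norm (conjugate_on Y h z' - conjugate_on Y h ?z - (z' - ?z) \<bullet> w) \<le> e * norm (z' - ?z)"
      if "norm (z' - ?z) < d" for z'
    proof -
      have "norm (k z' - w) \<le> e"
        using d[of z'] that by (simp add: dist_norm)
      then show ?thesis
        using est[of z'] by (meson mult_right_mono norm_ge_zero order_trans)
    qed
    then show "\<exists>d>0. \<forall>z'. norm (z' - ?z) < d \<longrightarrow>
        norm (conjugate_on Y h z' - conjugate_on Y h ?z - (z' - ?z) \<bullet> w) \<le> e * norm (z' - ?z)"
      using \<open>d > 0\<close> by blast
  qed
qed

section \<open>Minimisers over convex subsets of \<open>Y\<close>\<close>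

lemma mirror_map_minimizer_interior:
  assumes "convex C" "C \<subseteq> Y" and p: "p \<in> C" and q: "q \<in> C" "q \<in> interior Y"
    and min: "\<And>y. y \<in> C \<Longrightarrow> h p - z \<bullet> p \<le> h y - z \<bullet> y"
  shows "p \<in> interior Y"
proof (rule ccontr)
  assume "p \<notin> interior Y"
  have "p \<in> Y" using p assms(2) by blast
  then have fr: "p \<in> frontier Y"
    using \<open>p \<notin> interior Y\<close> closure_subset by (auto simp: frontier_def)
  have convY: "convex Y" and conth: "continuous_on Y h"
    using mirror by (auto simp: mirror_map_def)
  define d where "d = q - p"
  define x where "x t = p + t *\<^sub>R d" for t
  have x_alt: "x t = (1 - t) *\<^sub>R p + t *\<^sub>R q" for t
    by (simp add: x_def d_def algebra_simps)
  have xC: "x t \<in> C" if "0 < t" "t < 1" for t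
    unfolding x_alt using assms(1) p q that by (intro convexD_alt) auto
  have xint: "x t \<in> interior Y" if "0 < t" "t < 1" for t
  proof -
    have "p - t *\<^sub>R (p - q) \<in> interior Y"
      using mem_interior_convex_shrink[OF convY q(2) \<open>p \<in> Y\<close>] that by simp
    then show ?thesis by (simp add: x_alt algebra_simps)
  qed
  \<comment> \<open>The ball leaves room to move from \<open>q\<close> in every direction, and
    compactness gives a bound \<open>M\<close> independent of \<open>t\<close>.\<close>
  obtain r where "r > 0" and r: "cball q r \<subseteq> interior Y"
    using q open_contains_cball open_interior by blast
  have "compact (h ` cball q r)"
    using conth r interior_subset[of Y]
    by (intro compact_continuous_image compact_cball) (meson continuous_on_subset order_trans)
  then obtain M where M: "\<And>y. y \<in> cball q r \<Longrightarrow> h y \<le> M"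
    using compact_imp_bounded bounded_real by (metis abs_le_D1 imageI)
  have bound: "norm (grad h (x t)) \<le> (M - h (x t) - (1 - t) * (z \<bullet> d)) / r"
    if t: "0 < t" "t < 1" for t
  proof -
    let ?g = "grad h (x t)"
    have "h (x t) + ?g \<bullet> (p - x t) \<le> h p"
      by (rule mirror_map_gradient_ineq[OF xint[OF t] \<open>p \<in> Y\<close>])
    moreover have "h p - z \<bullet> p \<le> h (x t) - z \<bullet> x t"
      by (rule min[OF xC[OF t]])
    ultimately have "t * (z \<bullet> d) \<le> t * (?g \<bullet> d)"
      by (simp add: x_def algebra_simps)
    then have slope: "z \<bullet> d \<le> ?g \<bullet> d" using t by simp
    \<comment> \<open>This \<open>y\<close> maximises the linear form \<open>?g\<close> over the
      ball, so the gradient inequality picks up \<open>r * norm ?g\<close>. If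
      \<open>?g = 0\<close>, then \<open>y = q\<close>.\<close>
    define y where "y = q + r *\<^sub>R sgn ?g"
    have y: "y \<in> cball q r"
      using \<open>r > 0\<close> by (simp add: y_def dist_norm norm_sgn)
    then have "y \<in> Y" using r interior_subset by blast
    have "h (x t) + ?g \<bullet> (y - x t) \<le> M"
      using mirror_map_gradient_ineq[OF xint[OF t] \<open>y \<in> Y\<close>] M[OF y] by linarith
    moreover have "y - x t = (1 - t) *\<^sub>R d + r *\<^sub>R sgn ?g"
      by (simp add: y_def x_def d_def algebra_simps)
    moreover have "?g \<bullet> sgn ?g = norm ?g"
      by (cases "?g = 0") (simp_all add: sgn_div_norm dot_square_norm power2_eq_square)
    ultimately have "h (x t) + (1 - t) * (?g \<bullet> d) + r * norm ?g \<le> M"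
      by (simp only: inner_add_right inner_scaleR_right add.assoc)
    moreover have "(1 - t) * (z \<bullet> d) \<le> (1 - t) * (?g \<bullet> d)"
      using slope t by (intro mult_left_mono) auto
    ultimately show ?thesis
      using \<open>r > 0\<close> by (simp add: pos_le_divide_eq mult.commute)
  qed
  have ev: "\<forall>\<^sub>F t in at_right 0. 0 < t \<and> t < (1::real)"
    by (auto intro!: eventually_at_rightI[of 0 1])
  have xlim: "(x \<longlongrightarrow> p) (at_right 0)"
    unfolding x_def by (auto intro!: tendsto_eq_intros)
  \<comment> \<open>The filter at \<open>p\<close> excludes its centre, hence the second
    conjunct.\<close>
  have "\<forall>\<^sub>F t in at_right 0. x t \<in> interior Y \<and> x t \<noteq> p"
    using ev by (rule eventually_mono) (use xint \<open>p \<notin> interior Y\<close> in metis)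
  then have "filterlim x (at p within interior Y) (at_right 0)"
    using xlim by (simp add: filterlim_at)
  moreover have "filterlim (\<lambda>x. norm (grad h x)) at_top (at p within interior Y)"
    using mirror fr by (auto simp: mirror_map_def essentially_smooth_on_def)
  ultimately have "filterlim (\<lambda>t. norm (grad h (x t))) at_top (at_right 0)"
    by (rule filterlim_compose[rotated])
  moreover have "\<forall>\<^sub>F t in at_right 0.
      norm (grad h (x t)) \<le> (M - h (x t) - (1 - t) * (z \<bullet> d)) / r"
    using ev by eventually_elim (use bound in blast)
  ultimately have inf: "filterlim (\<lambda>t. (M - h (x t) - (1 - t) * (z \<bullet> d)) / r) at_top (at_right 0)"
    by (rule filterlim_at_top_mono)
  \<comment> \<open>Since \<open>h\<close> is continuous on \<open>Y\<close>, also at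
    \<open>p\<close>, the upper bound has a finite limit, against \<open>inf\<close>.\<close>
  have "((\<lambda>t. h (x t)) \<longlongrightarrow> h p) (at_right 0)"
    using conth xlim \<open>p \<in> Y\<close>
    by (rule continuous_on_tendsto_compose)
      (use ev in \<open>rule eventually_mono, use xint interior_subset in blast\<close>)
  then have "((\<lambda>t. (M - h (x t) - (1 - t) * (z \<bullet> d)) / r)
      \<longlongrightarrow> (M - h p - (1 - 0) * (z \<bullet> d)) / r) (at_right 0)"
    using \<open>r > 0\<close> by (intro tendsto_intros) auto
  then show False
    by (rule not_tendsto_and_filterlim_at_infinity[OF trivial_limit_at_right_real _
        filterlim_at_top_imp_at_infinity[OF inf]])
qed

text \<open>Minimality along the segment to \<open>q\<close> bounds the difference quotients of
  \<open>h\<close> below; then \<open>t\<close> tends to 0.\<close>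

lemma mirror_map_first_order_optimality:
  assumes "convex C" and p: "p \<in> C" "p \<in> interior Y" and q: "q \<in> C"
    and min: "\<And>y. y \<in> C \<Longrightarrow> h p - z \<bullet> p \<le> h y - z \<bullet> y"
  shows "z \<bullet> (q - p) \<le> grad h p \<bullet> (q - p)"
proof -
  have "z \<bullet> (q - p) \<le> (h (p + t *\<^sub>R (q - p)) - h p) / t" if "0 < t" "t < 1" for t
  proof -
    have "(1 - t) *\<^sub>R p + t *\<^sub>R q \<in> C"
      using assms(1) p q that by (intro convexD_alt) auto
    moreover have "(1 - t) *\<^sub>R p + t *\<^sub>R q = p + t *\<^sub>R (q - p)"
      by (simp add: algebra_simps)
    ultimately have "h p - z \<bullet> p \<le> h (p + t *\<^sub>R (q - p)) - z \<bullet> (p + t *\<^sub>R (q - p))"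
      using min by metis
    then show ?thesis
      using that by (simp add: pos_le_divide_eq inner_add_right mult.commute)
  qed
  then have "\<forall>\<^sub>F t in at_right 0. z \<bullet> (q - p) \<le> (h (p + t *\<^sub>R (q - p)) - h p) / t"
    by (auto intro!: eventually_at_rightI[of 0 1])
  from tendsto_lowerbound[OF GDERIV_directional[OF mirror_map_GDERIV[OF p(2)]] this]
  show ?thesis by simp
qed

end

text \<open>All values of \<open>h\<close> cancel. With \<open>y\<close> as
  \<open>\<pi>bar s\<close> and \<open>p\<close> as \<open>\<pi>tilde s\<close>, the gradient at
  \<open>\<pi>bar s\<close> also cancels from the claim.\<close>

lemma bregman_three_point:
  "bregman h x y - bregman h p y - bregman h x p = (grad h p - grad h y) \<bullet> (x - p)"
  by (simp add: bregman_def algebra_simps)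

theorem lemma4p1:
  fixes Y :: "(real ^ 'a) set"
    and h :: "real ^ 'a \<Rightarrow> real"
    and f :: "'t \<Rightarrow> 's \<times> 'a \<Rightarrow> real"
    and \<Theta> :: "'t set"
    and \<theta> :: 't
    and \<eta> :: real
    and \<pi> \<pi>bar \<pi>tilde :: "'s \<Rightarrow> real ^ 'a"
  assumes "mirror_map Y h"
    and "action_simplex \<subseteq> Y"
    and "\<eta> > 0"
    and "is_policy \<pi>"
    and "is_policy \<pi>bar"
    and "\<forall>s. \<pi>bar s \<in> interior Y"
    and "\<theta> \<in> \<Theta>"
    and "\<forall>s. \<pi>tilde s =
           arg_min_on (\<lambda>p. bregman h p (grad (conjugate_on Y h) (\<eta> *\<^sub>R action_vec (f \<theta>) s)))
             action_simplex"
  shows "\<forall>s. (\<eta> *\<^sub>R action_vec (f \<theta>) s - grad h (\<pi>bar s)) \<bullet> (\<pi> s - \<pi>tilde s)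
           \<le> bregman h (\<pi> s) (\<pi>bar s) - bregman h (\<pi>tilde s) (\<pi>bar s) - bregman h (\<pi> s) (\<pi>tilde s)"
proof
  fix s
  define z where "z = \<eta> *\<^sub>R action_vec (f \<theta>) s"
  define D where "D p = bregman h p (grad (conjugate_on Y h) z)" for p
  \<comment> \<open>Surjectivity of the gradient supplies the point \<open>w\<close> that is
    projected onto the simplex.\<close>
  have "z \<in> grad h ` interior Y"
    using assms(1) by (simp add: mirror_map_def)
  then obtain w where w: "w \<in> interior Y" "z = grad h w" by blast
  have D_eq: "D p = (h p - z \<bullet> p) + (z \<bullet> w - h w)" for p
    using grad_conjugate_on[OF assms(1) w(1)] w(2)
    by (simp add: D_def bregman_def inner_diff_right)
  have pol: "\<pi> s \<in> action_simplex" "\<pi>bar s \<in> action_simplex"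
    using assms(4,5) by (auto simp: is_policy_def)
  have "continuous_on action_simplex h"
    using assms(1,2) continuous_on_subset by (auto simp: mirror_map_def)
  then have "continuous_on action_simplex D"
    unfolding D_eq by (intro continuous_intros)
  then obtain p where p: "p \<in> action_simplex" "\<And>y. y \<in> action_simplex \<Longrightarrow> D p \<le> D y"
    using continuous_attains_inf[OF compact_action_simplex, of D] pol by blast
  have tilde: "\<pi>tilde s = arg_min_on D action_simplex"
    using assms(8) by (simp add: D_def[abs_def] z_def)
  have mem: "\<pi>tilde s \<in> action_simplex"
    unfolding tilde using p by (rule arg_min_on_attained)
  have "D (\<pi>tilde s) \<le> D y" if "y \<in> action_simplex" for y
    unfolding tilde using p that by (rule arg_min_on_attained(2))
  then have min: "h (\<pi>tilde s) - z \<bullet> \<pi>tilde s \<le> h y - z \<bullet> y" if "y \<in> action_simplex" for y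
    using that by (simp add: D_eq)
  \<comment> \<open>\<open>\<pi>bar s\<close> serves as the point of the simplex that is interior to
    \<open>Y\<close>.\<close>
  have "\<pi>tilde s \<in> interior Y"
    using mirror_map_minimizer_interior[OF assms(1) convex_action_simplex assms(2) mem pol(2) _ min]
      assms(6) by blast
  then have "z \<bullet> (\<pi> s - \<pi>tilde s) \<le> grad h (\<pi>tilde s) \<bullet> (\<pi> s - \<pi>tilde s)"
    using mirror_map_first_order_optimality[OF assms(1) convex_action_simplex mem _ pol(1) min] by blast
  then show "(\<eta> *\<^sub>R action_vec (f \<theta>) s - grad h (\<pi>bar s)) \<bullet> (\<pi> s - \<pi>tilde s)
      \<le> bregman h (\<pi> s) (\<pi>bar s) - bregman h (\<pi>tilde s) (\<pi>bar s) - bregman h (\<pi> s) (\<pi>tilde s)"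
    unfolding bregman_three_point by (simp add: z_def inner_diff_left)
qed

end
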